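(* Let $G=K_{1,m}$ be a star of order $m+1\geq 4$. Then for every permutation $\alpha$ of the vertex indices, $tpc(P_\alpha(G))=3$.
   Context: All graphs are simple, finite and undirected. For a graph $G$ with $V(G)=\{v_1,\dots,v_n\}$ and a permutation $\alpha$ of $[n]$, let $G'$ be a disjoint copy of $G$ with vertices $u_1,\dots,u_n$, $u_i$ corresponding to $v_i$; the permutation graph $P_\alpha(G)$ is obtained from $G\cup G'$ by adding all edges $v_iu_{\alpha(i)}$, $i\in[n]$. A graph is total-colored if all its vertices and edges are assigned colors. A path in a total-colored graph is a total proper path if (i) any two adjacent edges on the path differ in color, (ii) any two adjacent internal vertices of the path differ in color, and (iii) every internal vertex of the path differs in color from the edges of the path incident with it. A total-colored graph is total-proper connected if any two vertices are joined by a total proper path. For a connected graph $G$, $tpc(G)$ is the smallest number of colors in a total-coloring making $G$ total-proper connected. *)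

theory Defs
  imports Main "HOL-Combinatorics.Permutations"
begin

text \<open>Simple undirected graphs; edges are two-element sets of vertices.\<close>

record 'a ugraph =
  verts :: "'a set"
  edges :: "'a set set"

text \<open>\<open>complete_bipartite p q G\<close>: the graph \<open>G\<close> is a \<open>K_{p,q}\<close>.
  The star \<open>K_{1,m}\<close> is the case \<open>p = 1\<close>, \<open>q = m\<close>.\<close>

definition complete_bipartite :: "nat \<Rightarrow> nat \<Rightarrow> 'a ugraph \<Rightarrow> bool" where
  "complete_bipartite p q G \<longleftrightarrow>
     (\<exists>A B. finite A \<and> finite B \<and> A \<inter> B = {} \<and> card A = p \<and> card B = q \<and>
            verts G = A \<union> B \<and> edges G = {{a, b} | a b. a \<in> A \<and> b \<in> B})"

text \<open>The vertices of \<open>G\<close> are enumerated as \<open>v 1, \<dots>, v n\<close> with \<open>n = card (verts G)\<close>.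
  \<open>Inl (v i)\<close> is the vertex \<open>v_i\<close> of \<open>G\<close> and \<open>Inr (v i)\<close> is the corresponding
  vertex \<open>u_i\<close> of the disjoint copy.\<close>

definition permutation_graph :: "(nat \<Rightarrow> 'a) \<Rightarrow> (nat \<Rightarrow> nat) \<Rightarrow> 'a ugraph \<Rightarrow> ('a + 'a) ugraph" where
  "permutation_graph v \<alpha> G =
     \<lparr> verts = Inl ` verts G \<union> Inr ` verts G,
       edges = (\<lambda>e. Inl ` e) ` edges G \<union> (\<lambda>e. Inr ` e) ` edges G
             \<union> {{Inl (v i), Inr (v (\<alpha> i))} | i. i \<in> {1..card (verts G)}} \<rparr>"

definition is_path :: "'a ugraph \<Rightarrow> 'a list \<Rightarrow> bool" where
  "is_path G p \<longleftrightarrow> p \<noteq> [] \<and> distinct p \<and> set p \<subseteq> verts G \<and>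
     (\<forall>i. i + 1 < length p \<longrightarrow> {p ! i, p ! (i + 1)} \<in> edges G)"

text \<open>A total-coloring is a pair of a vertex coloring \<open>f\<close> and an edge coloring \<open>g\<close>.
  The internal vertices of a path \<open>p\<close> are the \<open>p ! i\<close> with \<open>0 < i\<close> and \<open>i + 1 < length p\<close>.\<close>

definition total_proper_path ::
    "'a ugraph \<Rightarrow> ('a \<Rightarrow> nat) \<Rightarrow> ('a set \<Rightarrow> nat) \<Rightarrow> 'a list \<Rightarrow> bool" where
  "total_proper_path G f g p \<longleftrightarrow> is_path G p \<and>
     (\<forall>i. i + 2 < length p \<longrightarrow> g {p ! i, p ! (i + 1)} \<noteq> g {p ! (i + 1), p ! (i + 2)}) \<and>
     (\<forall>i. 0 < i \<and> i + 2 < length p \<longrightarrow> f (p ! i) \<noteq> f (p ! (i + 1))) \<and>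
     (\<forall>i. 0 < i \<and> i + 1 < length p \<longrightarrow>
        f (p ! i) \<noteq> g {p ! (i - 1), p ! i} \<and> f (p ! i) \<noteq> g {p ! i, p ! (i + 1)})"

definition total_proper_connected :: "'a ugraph \<Rightarrow> ('a \<Rightarrow> nat) \<Rightarrow> ('a set \<Rightarrow> nat) \<Rightarrow> bool" where
  "total_proper_connected G f g \<longleftrightarrow>
     (\<forall>x \<in> verts G. \<forall>y \<in> verts G. x \<noteq> y \<longrightarrow>
        (\<exists>p. total_proper_path G f g p \<and> hd p = x \<and> last p = y))"

definition num_colors :: "'a ugraph \<Rightarrow> ('a \<Rightarrow> nat) \<Rightarrow> ('a set \<Rightarrow> nat) \<Rightarrow> nat" where
  "num_colors G f g = card (f ` verts G \<union> g ` edges G)"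

text \<open>Only meaningful for finite connected graphs; otherwise the minimum may range over
  an empty set, or \<open>card\<close> may be applied to an infinite one.\<close>

definition tpc :: "'a ugraph \<Rightarrow> nat" where
  "tpc G = (LEAST k. \<exists>f g. total_proper_connected G f g \<and> num_colors G f g = k)"

end

theory Submission
  imports Defs
begin

text \<open>Two non-adjacent vertices need a path with an internal vertex, and this vertex and its two
  path edges already use three colors. Conversely, write \<open>c\<close>, \<open>c'\<close> for the two centers. All but at
  most two of the leaves of the two stars are joined in pairs, forming pages \<open>c - a - b - c'\<close>. In a
  3-coloring the sequence of colors along a total proper path (without the endpoints) is periodic
  with period 3. Both centers get color 2, one page \<open>K\<close> gets edge colors \<open>3, 2, 1\<close> and every other
  page gets edge colors \<open>1, 2, 3\<close>, so that leaves of different pages can be joined through \<open>K\<close>. If a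
  leaf \<open>s\<close> of \<open>c\<close> is matched with \<open>c'\<close>, then a leaf \<open>t\<close> of \<open>c'\<close> is matched with \<open>c\<close>; the two
  edges at \<open>s\<close> get color 3 and those at \<open>t\<close> get color 1.\<close>

section \<open>Total proper paths: recursion and reversal\<close>

definition tp_joined :: "'a ugraph \<Rightarrow> ('a \<Rightarrow> nat) \<Rightarrow> ('a set \<Rightarrow> nat) \<Rightarrow> 'a \<Rightarrow> 'a \<Rightarrow> bool" where
  "tp_joined G f g x y \<longleftrightarrow> (\<exists>p. total_proper_path G f g p \<and> hd p = x \<and> last p = y)"

lemma tp_joinedI:
  "total_proper_path G f g p \<Longrightarrow> hd p = x \<Longrightarrow> last p = y \<Longrightarrow> tp_joined G f g x y"
  by (auto simp: tp_joined_def)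

lemma all_nat_split: "(\<forall>i. P i) \<longleftrightarrow> P 0 \<and> (\<forall>i. P (Suc i))"
  by (metis not0_implies_Suc)

lemma total_proper_path_pair:
  "total_proper_path G f g [x, y] \<longleftrightarrow>
     x \<noteq> y \<and> x \<in> verts G \<and> y \<in> verts G \<and> {x, y} \<in> edges G"
  by (auto simp: total_proper_path_def is_path_def less_Suc_eq)

text \<open>Turns the index conditions into a recursion by which simp can check explicit paths.
  Prepending \<open>x\<close> makes \<open>y\<close> internal, so all new color conditions concern
  \<open>y\<close>; \<open>z\<close> is internal only if \<open>zs\<close> is nonempty, hence the
  guard on \<open>f y \<noteq> f z\<close>.\<close>

lemma total_proper_path_Cons:
  "total_proper_path G f g (x # y # z # zs) \<longleftrightarrow>
     x \<in> verts G \<and> x \<notin> set (y # z # zs) \<and> {x, y} \<in> edges G \<and>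
     g {x, y} \<noteq> g {y, z} \<and> f y \<noteq> g {x, y} \<and> f y \<noteq> g {y, z} \<and>
     (zs \<noteq> [] \<longrightarrow> f y \<noteq> f z) \<and> total_proper_path G f g (y # z # zs)"
proof -
  let ?p = "x # y # z # zs" and ?q = "y # z # zs"
  have 1: "is_path G ?p \<longleftrightarrow> x \<in> verts G \<and> x \<notin> set ?q \<and> {x, y} \<in> edges G \<and> is_path G ?q"
    unfolding is_path_def
    by (subst all_nat_split) auto
  have 2: "(\<forall>i. i + 2 < length ?p \<longrightarrow> g {?p ! i, ?p ! (i + 1)} \<noteq> g {?p ! (i + 1), ?p ! (i + 2)}) \<longleftrightarrow>
     g {x, y} \<noteq> g {y, z} \<and>
     (\<forall>i. i + 2 < length ?q \<longrightarrow> g {?q ! i, ?q ! (i + 1)} \<noteq> g {?q ! (i + 1), ?q ! (i + 2)})"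
    by (subst all_nat_split) simp
  have 3: "(\<forall>i. 0 < i \<and> i + 2 < length ?p \<longrightarrow> f (?p ! i) \<noteq> f (?p ! (i + 1))) \<longleftrightarrow>
     (zs \<noteq> [] \<longrightarrow> f y \<noteq> f z) \<and>
     (\<forall>i. 0 < i \<and> i + 2 < length ?q \<longrightarrow> f (?q ! i) \<noteq> f (?q ! (i + 1)))" (is "?L \<longleftrightarrow> ?a \<and> ?R")
  proof -
    \<comment> \<open>Index 0 is vacuous because of the guard \<open>0 < i\<close>; index 1 then
      yields the condition at \<open>y\<close>. The last step splits the right-hand side, to put the
      guard back for the shorter path.\<close>
    have "?L \<longleftrightarrow> (\<forall>i. i + 2 < length ?q \<longrightarrow> f (?q ! i) \<noteq> f (?q ! (i + 1)))"
      by (subst all_nat_split) simp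
    also have "\<dots> \<longleftrightarrow> ?a \<and> (\<forall>i. Suc i + 2 < length ?q \<longrightarrow> f (?q ! Suc i) \<noteq> f (?q ! (Suc i + 1)))"
      by (subst all_nat_split) simp
    also have "\<dots> \<longleftrightarrow> ?a \<and> ?R"
      by (subst (2) all_nat_split) simp
    finally show ?thesis .
  qed
  let ?h = "\<lambda>p i. f (p ! i) \<noteq> g {p ! (i - 1), p ! i} \<and> f (p ! i) \<noteq> g {p ! i, p ! (i + 1)}"
  have 4: "(\<forall>i. 0 < i \<and> i + 1 < length ?p \<longrightarrow> ?h ?p i) \<longleftrightarrow>
     f y \<noteq> g {x, y} \<and> f y \<noteq> g {y, z} \<and> (\<forall>i. 0 < i \<and> i + 1 < length ?q \<longrightarrow> ?h ?q i)"
    (is "?L \<longleftrightarrow> ?a \<and> ?b \<and> ?R")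
  proof -
    have "?L \<longleftrightarrow> (\<forall>i. i + 1 < length ?q \<longrightarrow> ?h ?p (Suc i))"
      by (subst all_nat_split) simp
    also have "\<dots> \<longleftrightarrow> ?a \<and> ?b \<and> (\<forall>i. Suc i + 1 < length ?q \<longrightarrow> ?h ?p (Suc (Suc i)))"
      by (subst all_nat_split) simp
    also have "\<dots> \<longleftrightarrow> ?a \<and> ?b \<and> ?R"
      by (subst (2) all_nat_split) simp
    finally show ?thesis .
  qed
  show ?thesis
    unfolding total_proper_path_def 1 2 3 4 by blast
qed

lemma total_proper_path_rev:
  assumes "total_proper_path G f g p"
  shows "total_proper_path G f g (rev p)"
proof -
  let ?n = "length p"
  have p: "p \<noteq> []" "distinct p" "set p \<subseteq> verts G"
    and e: "\<And>i. i + 1 < ?n \<Longrightarrow> {p ! i, p ! (i + 1)} \<in> edges G"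
    and gg: "\<And>i. i + 2 < ?n \<Longrightarrow> g {p ! i, p ! (i + 1)} \<noteq> g {p ! (i + 1), p ! (i + 2)}"
    and ff: "\<And>i. 0 < i \<Longrightarrow> i + 2 < ?n \<Longrightarrow> f (p ! i) \<noteq> f (p ! (i + 1))"
    and fg: "\<And>i. 0 < i \<Longrightarrow> i + 1 < ?n \<Longrightarrow>
        f (p ! i) \<noteq> g {p ! (i - 1), p ! i} \<and> f (p ! i) \<noteq> g {p ! i, p ! (i + 1)}"
    using assms unfolding total_proper_path_def is_path_def by blast+
  \<comment> \<open>Every condition at \<open>i\<close> for the reversed path becomes the same
    condition at \<open>j\<close> or \<open>j + 1\<close> for \<open>p\<close>, with
    \<open>j\<close> counted from the other end.\<close>
  have r: "rev p ! i = p ! j" if "?n = i + j + 1" for i j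
    using that by (simp add: rev_nth)
  have "{rev p ! i, rev p ! (i + 1)} \<in> edges G" if i: "i + 1 < ?n" for i
  proof -
    obtain j where j: "?n = i + 2 + j" using le_Suc_ex[of "i + 2" ?n] i by auto
    have "rev p ! i = p ! (j + 1)" "rev p ! (i + 1) = p ! j"
      using j by (auto intro!: r)
    then show ?thesis using e[of j] j by (simp add: insert_commute)
  qed
  moreover have "g {rev p ! i, rev p ! (i + 1)} \<noteq> g {rev p ! (i + 1), rev p ! (i + 2)}"
    if i: "i + 2 < ?n" for i
  proof -
    obtain j where j: "?n = i + 3 + j" using le_Suc_ex[of "i + 3" ?n] i by auto
    have "rev p ! i = p ! (j + 2)" "rev p ! (i + 1) = p ! (j + 1)" "rev p ! (i + 2) = p ! j"
      using j by (auto intro!: r)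
    then show ?thesis using gg[of j] j by (auto simp: insert_commute)
  qed
  \<comment> \<open>Reversal exchanges the two guards: \<open>0 < i\<close> gives the upper bound
    needed at \<open>j + 1\<close>, and the upper bound on \<open>i\<close> gives the existence of
    \<open>j\<close>.\<close>
  moreover have "f (rev p ! i) \<noteq> f (rev p ! (i + 1))" if i: "0 < i" "i + 2 < ?n" for i
  proof -
    obtain j where j: "?n = i + 3 + j" using le_Suc_ex[of "i + 3" ?n] i by auto
    have "rev p ! i = p ! (j + 2)" "rev p ! (i + 1) = p ! (j + 1)"
      using j by (auto intro!: r)
    then show ?thesis using i ff[of "j + 1"] j by auto
  qed
  moreover have "f (rev p ! i) \<noteq> g {rev p ! (i - 1), rev p ! i} \<and>
      f (rev p ! i) \<noteq> g {rev p ! i, rev p ! (i + 1)}" if i: "0 < i" "i + 1 < ?n" for i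
  proof -
    obtain j where j: "?n = i + 2 + j" using le_Suc_ex[of "i + 2" ?n] i by auto
    have "rev p ! (i - 1) = p ! (j + 2)" "rev p ! i = p ! (j + 1)" "rev p ! (i + 1) = p ! j"
      using i j by (auto intro!: r)
    then show ?thesis using fg[of "j + 1"] i j by (auto simp: insert_commute)
  qed
  ultimately show ?thesis
    using p by (auto simp: total_proper_path_def is_path_def)
qed

lemma tp_joined_sym: "tp_joined G f g x y \<Longrightarrow> tp_joined G f g y x"
  unfolding tp_joined_def
  by (metis hd_rev last_rev total_proper_path_rev)

section \<open>Lower bound: three colors are needed\<close>

lemma three_le_num_colors:
  assumes "total_proper_connected G f g" "finite (verts G)" "finite (edges G)"
    and "x \<in> verts G" "y \<in> verts G" "x \<noteq> y" "{x, y} \<notin> edges G"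
  shows "3 \<le> num_colors G f g"
proof -
  obtain p where p: "total_proper_path G f g p" "hd p = x" "last p = y"
    using assms unfolding total_proper_connected_def by meson
  obtain a b d r where q: "p = a # b # d # r"
  \<comment> \<open>The rule only serves to split lists into length 0, 1 and at least 2. Length 1
    contradicts \<open>x \<noteq> y\<close>, length 2 the non-adjacency.\<close>
  proof (cases p rule: remdups_adj.cases)
    case 1
    then show ?thesis using p by (simp add: total_proper_path_def is_path_def)
  next
    case (2 a)
    then show ?thesis using p assms by simp
  next
    case (3 a b zs)
    then show ?thesis
      using p assms that by (cases zs) (auto simp: total_proper_path_pair)
  qed
  have t: "total_proper_path G f g (a # b # d # r)" using p q by simp
  have bV: "b \<in> verts G" and abE: "{a, b} \<in> edges G" and bdE: "{b, d} \<in> edges G"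
    using t by (cases r; simp add: total_proper_path_Cons total_proper_path_pair)+
  have "card {f b, g {a, b}, g {b, d}} = 3"
    using t by (auto simp: total_proper_path_Cons)
  moreover have "{f b, g {a, b}, g {b, d}} \<subseteq> f ` verts G \<union> g ` edges G"
    using bV abE bdE by blast
  ultimately show ?thesis
    unfolding num_colors_def by (metis assms(2,3) card_mono finite_UnI finite_imageI)
qed

section \<open>The coloring by pages\<close>

text \<open>Here \<open>k, k'\<close> is the page \<open>K\<close>, and \<open>P i, Q i\<close> are
  the other pages. \<open>S\<close> and \<open>T\<close> hold the leaves of \<open>c\<close> matched
  with \<open>c'\<close> and the leaves of \<open>c'\<close> matched with \<open>c\<close>; as they
  may be empty, the case of matched centers is included. They carry no prescribed vertex colors,
  since the chosen paths use them only as endpoints.\<close>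

lemma pages_total_proper_connected:
  fixes H :: "'b ugraph" and P Q :: "'i \<Rightarrow> 'b"
  assumes V: "verts H = {c, c', k, k'} \<union> P ` I \<union> Q ` I \<union> S \<union> T"
    and dist: "distinct [c, c', k, k']"
      "{c, c', k, k'} \<inter> (P ` I \<union> Q ` I \<union> S \<union> T) = {}"
      "inj_on P I" "inj_on Q I" "P ` I \<inter> Q ` I = {}" "S \<inter> T = {}"
      "(P ` I \<union> Q ` I) \<inter> (S \<union> T) = {}"
    and S1: "\<And>s s'. s \<in> S \<Longrightarrow> s' \<in> S \<Longrightarrow> s = s'"
    and T1: "\<And>t t'. t \<in> T \<Longrightarrow> t' \<in> T \<Longrightarrow> t = t'"
    and cols: "f c = 2" "f c' = 2" "f k = 1" "f k' = 3"
      "\<And>i. i \<in> I \<Longrightarrow> f (P i) = 3" "\<And>i. i \<in> I \<Longrightarrow> f (Q i) = 1"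
    and eK: "{c, k} \<in> edges H" "{k, k'} \<in> edges H" "{c', k'} \<in> edges H"
    and eI: "\<And>i. i \<in> I \<Longrightarrow> {c, P i} \<in> edges H" "\<And>i. i \<in> I \<Longrightarrow> {P i, Q i} \<in> edges H"
      "\<And>i. i \<in> I \<Longrightarrow> {c', Q i} \<in> edges H"
    and eS: "\<And>s. s \<in> S \<Longrightarrow> {c, s} \<in> edges H" "\<And>s. s \<in> S \<Longrightarrow> {c', s} \<in> edges H"
    and eT: "\<And>t. t \<in> T \<Longrightarrow> {c, t} \<in> edges H" "\<And>t. t \<in> T \<Longrightarrow> {c', t} \<in> edges H"
    and gK: "g {c, k} = 3" "g {k, k'} = 2" "g {c', k'} = 1"
    and gI: "\<And>i. i \<in> I \<Longrightarrow> g {c, P i} = 1" "\<And>i. i \<in> I \<Longrightarrow> g {P i, Q i} = 2"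
      "\<And>i. i \<in> I \<Longrightarrow> g {c', Q i} = 3"
    and gS: "\<And>s. s \<in> S \<Longrightarrow> g {c, s} = 3" "\<And>s. s \<in> S \<Longrightarrow> g {c', s} = 3"
    and gT: "\<And>t. t \<in> T \<Longrightarrow> g {c, t} = 1" "\<And>t. t \<in> T \<Longrightarrow> g {c', t} = 1"
  shows "total_proper_connected H f g"
proof -
  have eq: "\<And>i j. i \<in> I \<Longrightarrow> j \<in> I \<Longrightarrow> P i = P j \<longleftrightarrow> i = j"
    "\<And>i j. i \<in> I \<Longrightarrow> j \<in> I \<Longrightarrow> Q i = Q j \<longleftrightarrow> i = j"
    using dist(3,4) by (auto simp: inj_on_eq_iff)
  have ne: "c \<noteq> c'" "c \<noteq> k" "c \<noteq> k'" "c' \<noteq> k" "c' \<noteq> k'" "k \<noteq> k'"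
    "\<And>i j. i \<in> I \<Longrightarrow> j \<in> I \<Longrightarrow> P i \<noteq> Q j"
    "\<And>s t. s \<in> S \<Longrightarrow> t \<in> T \<Longrightarrow> s \<noteq> t"
    "\<And>i. i \<in> I \<Longrightarrow> c \<noteq> P i" "\<And>i. i \<in> I \<Longrightarrow> c' \<noteq> P i"
    "\<And>i. i \<in> I \<Longrightarrow> k \<noteq> P i" "\<And>i. i \<in> I \<Longrightarrow> k' \<noteq> P i"
    "\<And>i. i \<in> I \<Longrightarrow> c \<noteq> Q i" "\<And>i. i \<in> I \<Longrightarrow> c' \<noteq> Q i"
    "\<And>i. i \<in> I \<Longrightarrow> k \<noteq> Q i" "\<And>i. i \<in> I \<Longrightarrow> k' \<noteq> Q i"
    "\<And>s. s \<in> S \<Longrightarrow> c \<noteq> s" "\<And>s. s \<in> S \<Longrightarrow> c' \<noteq> s" "\<And>s. s \<in> S \<Longrightarrow> k \<noteq> s" "\<And>s. s \<in> S \<Longrightarrow> k' \<noteq> s"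
    "\<And>s. s \<in> T \<Longrightarrow> c \<noteq> s" "\<And>s. s \<in> T \<Longrightarrow> c' \<noteq> s" "\<And>s. s \<in> T \<Longrightarrow> k \<noteq> s" "\<And>s. s \<in> T \<Longrightarrow> k' \<noteq> s"
    "\<And>i s. i \<in> I \<Longrightarrow> s \<in> S \<Longrightarrow> P i \<noteq> s" "\<And>i s. i \<in> I \<Longrightarrow> s \<in> T \<Longrightarrow> P i \<noteq> s"
    "\<And>i s. i \<in> I \<Longrightarrow> s \<in> S \<Longrightarrow> Q i \<noteq> s" "\<And>i s. i \<in> I \<Longrightarrow> s \<in> T \<Longrightarrow> Q i \<noteq> s"
    using dist by auto
  have mem: "c \<in> verts H" "c' \<in> verts H" "k \<in> verts H" "k' \<in> verts H"
    "\<And>i. i \<in> I \<Longrightarrow> P i \<in> verts H" "\<And>i. i \<in> I \<Longrightarrow> Q i \<in> verts H"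
    "\<And>s. s \<in> S \<Longrightarrow> s \<in> verts H" "\<And>t. t \<in> T \<Longrightarrow> t \<in> verts H"
    using V by auto
  note ed = eK eI eS eT gK gI gS gT
  \<comment> \<open>Paths traverse edges both ways; these equations restore the orientation of the
    hypotheses.\<close>
  have flip: "{k, c} = {c, k}" "{k', k} = {k, k'}" "{k', c'} = {c', k'}"
    "\<And>i. {P i, c} = {c, P i}" "\<And>i. {Q i, P i} = {P i, Q i}" "\<And>i. {Q i, c'} = {c', Q i}"
    "\<And>s. s \<in> S \<union> T \<Longrightarrow> {s, c} = {c, s}" "\<And>s. s \<in> S \<union> T \<Longrightarrow> {s, c'} = {c', s}"
    by auto
  note rules = total_proper_path_pair total_proper_path_Cons eq ne ne[symmetric] mem cols ed flip
  let ?J = "tp_joined H f g"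
  have hubs: "?J c c'" "?J c k" "?J c k'" "?J c' k" "?J c' k'"
    using tp_joinedI[of H f g "[c, k, k', c']"] tp_joinedI[of H f g "[c, k]"]
      tp_joinedI[of H f g "[c, k, k']"] tp_joinedI[of H f g "[c', k', k]"]
      tp_joinedI[of H f g "[c', k']"]
    by (simp_all add: rules)
  have kk: "?J k k'"
    using tp_joinedI[of H f g "[k, k']"] by (simp add: rules)
  have pg: "?J c (P i)" "?J c (Q i)" "?J c' (P i)" "?J c' (Q i)"
      "?J k (P i)" "?J k (Q i)" "?J k' (P i)" "?J k' (Q i)" if "i \<in> I" for i
    using that tp_joinedI[of H f g "[c, P i]"] tp_joinedI[of H f g "[c, P i, Q i]"]
      tp_joinedI[of H f g "[c', Q i, P i]"] tp_joinedI[of H f g "[c', Q i]"]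
      tp_joinedI[of H f g "[k, c, P i]"] tp_joinedI[of H f g "[k, k', c', Q i]"]
      tp_joinedI[of H f g "[k', k, c, P i]"] tp_joinedI[of H f g "[k', c', Q i]"]
    by (simp_all add: rules)
  have PQ: "?J (P i) (Q j)" if "i \<in> I" "j \<in> I" for i j
  proof (cases "i = j")
    case True
    then show ?thesis using that tp_joinedI[of H f g "[P i, Q i]"] by (simp add: rules)
  next
    case False
    \<comment> \<open>Page \<open>i\<close> is left through \<open>c\<close> by an edge of color 1.
      Running through \<open>K\<close> gives the color sequence 1, 2, 3, 1, 2, 3, 1, 2, 3, whose
      last edge is the one from \<open>c'\<close> to \<open>Q j\<close>. A second ordinary page in
      place of \<open>K\<close> would repeat color 1 at \<open>c\<close>.\<close>
    then show ?thesis using that tp_joinedI[of H f g "[P i, c, k, k', c', Q j]"] by (simp add: rules)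
  qed
  have PP: "?J (P i) (P j)" "?J (Q i) (Q j)" if "i \<in> I" "j \<in> I" "i \<noteq> j" for i j
    using that tp_joinedI[of H f g "[P i, c, k, k', c', Q j, P j]"]
      tp_joinedI[of H f g "[Q i, c', k', k, c, P j, Q j]"] by (simp_all add: rules)
  have s: "?J c s" "?J c' s" "?J k s" "?J k' s" if "s \<in> S" for s
    using that tp_joinedI[of H f g "[c, s]"] tp_joinedI[of H f g "[c', s]"]
      tp_joinedI[of H f g "[k, k', c', s]"] tp_joinedI[of H f g "[k', c', s]"]
    by (simp_all add: rules)
  have t: "?J c s" "?J c' s" "?J k s" "?J k' s" if "s \<in> T" for s
    using that tp_joinedI[of H f g "[c, s]"] tp_joinedI[of H f g "[c', s]"]
      tp_joinedI[of H f g "[k, c, s]"] tp_joinedI[of H f g "[k', k, c, s]"]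
    by (simp_all add: rules)
  have sP: "?J (P i) s" "?J (Q i) s" if "i \<in> I" "s \<in> S" for i s
    using that tp_joinedI[of H f g "[P i, c, s]"] tp_joinedI[of H f g "[Q i, P i, c, s]"]
    by (simp_all add: rules)
  have tP: "?J (P i) s" "?J (Q i) s" if "i \<in> I" "s \<in> T" for i s
    using that tp_joinedI[of H f g "[P i, Q i, c', s]"] tp_joinedI[of H f g "[Q i, c', s]"]
    by (simp_all add: rules)
  have st: "?J s t" if "s \<in> S" "t \<in> T" for s t
    using that tp_joinedI[of H f g "[s, c, t]"] by (simp add: rules)
  \<comment> \<open>Vacuous: \<open>S\<close> and \<open>T\<close> have at most one element
    each.\<close>
  have ST: "?J s s'" if "s \<in> S \<and> s' \<in> S \<or> s \<in> T \<and> s' \<in> T" "s \<noteq> s'" for s s'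
    using that S1 T1 by blast
  note J = hubs kk pg PQ PP s t sP tP st ST
  \<comment> \<open>Each pair of vertex classes was treated in one order only; symmetry supplies the
    other.\<close>
  have "?J x y" if "x \<in> verts H" "y \<in> verts H" "x \<noteq> y" for x y
    using that unfolding V
    by (elim UnE imageE insertE emptyE) (simp_all add: J J[THEN tp_joined_sym] eq)
  then show ?thesis
    unfolding total_proper_connected_def tp_joined_def by blast
qed

section \<open>Permutation graphs of stars\<close>

theorem theorem4p2:
  fixes G :: "'a ugraph" and m :: nat and v :: "nat \<Rightarrow> 'a" and \<alpha> :: "nat \<Rightarrow> nat"
  assumes "complete_bipartite 1 m G"
    and "m + 1 \<ge> 4"
    and "bij_betw v {1..m + 1} (verts G)"
    and "\<alpha> permutes {1..m + 1}"
  shows "tpc (permutation_graph v \<alpha> G) = 3"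
proof -
  obtain c B where B: "finite B" "c \<notin> B" "card B = m" "verts G = insert c B"
    and EG: "edges G = {{c, b} | b. b \<in> B}"
    using assms(1) unfolding complete_bipartite_def by (auto simp: card_1_singleton_iff)
  have cardV: "card (verts G) = m + 1"
    using B by simp
  \<comment> \<open>Transports \<open>\<alpha>\<close> from indices to vertices, so that the
    matching joins \<open>Inl x\<close> to \<open>Inr (\<sigma> x)\<close> and the enumeration
    disappears.\<close>
  define \<sigma> where "\<sigma> = v \<circ> \<alpha> \<circ> inv_into {1..m + 1} v"
  have "bij_betw \<sigma> (verts G) (verts G)"
    unfolding \<sigma>_def using assms(3,4)
    by (meson bij_betw_inv_into bij_betw_trans permutes_imp_bij)
  then have \<sigma>: "inj_on \<sigma> (insert c B)" "\<sigma> ` insert c B = insert c B"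
    by (simp_all add: bij_betw_def B)
  define H where "H = permutation_graph v \<alpha> G"
  have VH: "verts H = Inl ` insert c B \<union> Inr ` insert c B"
    by (simp add: H_def permutation_graph_def B)
  have *: "{{Inl (v i), Inr (v (\<alpha> i))} | i. i \<in> {1..m + 1}} = {{Inl x, Inr (\<sigma> x)} | x. x \<in> insert c B}"
  proof -
    have "(\<lambda>x. {Inl x, Inr (\<sigma> x)}) ` verts G = (\<lambda>x. {Inl x, Inr (\<sigma> x)}) ` v ` {1..m + 1}"
      using assms(3) by (simp add: bij_betw_def)
    also have "\<dots> = (\<lambda>i. {Inl (v i), Inr (v (\<alpha> i))}) ` {1..m + 1}"
      unfolding image_image
    proof (rule image_cong[OF refl])
      fix i assume "i \<in> {1..m + 1}"
      then have "inv_into {1..m + 1} v (v i) = i"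
        using assms(3) by (meson bij_betw_imp_inj_on inv_into_f_f)
      then show "{Inl (v i), Inr (\<sigma> (v i))} = {Inl (v i), Inr (v (\<alpha> i))}"
        by (simp add: \<sigma>_def)
    qed
    finally show ?thesis unfolding B(4) by blast
  qed
  have EH: "edges H = {{Inl c, Inl b} | b. b \<in> B} \<union> {{Inr c, Inr b} | b. b \<in> B}
      \<union> {{Inl x, Inr (\<sigma> x)} | x. x \<in> insert c B}"
  proof -
    have img: "(`) h ` {{c, b} | b. b \<in> B} = {{h c, h b} | b. b \<in> B}" for h :: "'a \<Rightarrow> 'a + 'a"
      by (auto simp: image_iff) (metis image_empty image_insert)
    show ?thesis
      unfolding H_def permutation_graph_def ugraph.simps cardV EG img * ..
  qed
  have finV: "finite (verts H)" and finE: "finite (edges H)"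
    unfolding VH EH using B by simp_all
  \<comment> \<open>Two leaves of the same star are non-adjacent, as the lower bound
    requires.\<close>
  obtain b1 b2 where b: "b1 \<in> B" "b2 \<in> B" "b1 \<noteq> b2"
    using assms(2) B(1,3) card_le_Suc0_iff_eq[of B] by fastforce
  have lower: "3 \<le> num_colors H f g" if "total_proper_connected H f g" for f g
    using that finV finE by (rule three_le_num_colors[where x = "Inl b1" and y = "Inl b2"])
      (use b B(2) in \<open>auto simp: VH EH doubleton_eq_iff\<close>)
  \<comment> \<open>By injectivity at most one of \<open>b1\<close>, \<open>b2\<close> is sent to
    the center; the other one starts the page \<open>K\<close>.\<close>
  obtain k where k: "k \<in> B" "\<sigma> k \<noteq> c"
    using b \<sigma>(1) by (metis inj_on_def insertI2)
  \<comment> \<open>The edges of color 3: at the first center those to \<open>k\<close> and to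
    \<open>S\<close>, at the second center those to the ordinary pages and to \<open>S\<close>. In
    \<open>g\<close> the other edges at a center get color 1 and the middle edges of pages color
    2.\<close>
  define E3 where "E3 = {{Inl c, Inl a} | a. a \<in> B \<and> (a = k \<or> \<sigma> a = c)}
      \<union> {{Inr c, Inr b} | b. b \<in> B \<and> b \<noteq> \<sigma> k \<and> b \<noteq> \<sigma> c}
      \<union> {{Inl a, Inr c} | a. a \<in> B \<and> \<sigma> a = c}"
  define g :: "('a + 'a) set \<Rightarrow> nat" where
    "g e = (if e \<in> E3 then 3 else if Inl c \<in> e \<or> Inr c \<in> e then 1 else 2)" for e
  define f :: "'a + 'a \<Rightarrow> nat" where
    "f x = (if x = Inl c \<or> x = Inr c then 2
            else if x = Inl k then 1 else if x = Inr (\<sigma> k) then 3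
            else case x of Inl _ \<Rightarrow> 3 | Inr _ \<Rightarrow> 1)" for x
  define I where "I = {a \<in> B. a \<noteq> k \<and> \<sigma> a \<noteq> c}"
  define S0 where "S0 = {a \<in> B. \<sigma> a = c}"
  define S :: "('a + 'a) set" where "S = Inl ` S0"
  \<comment> \<open>Removing \<open>Inr c\<close> makes \<open>T\<close> empty if
    \<open>\<sigma>\<close> fixes the center. In that case \<open>S\<close> is empty too; otherwise
    both are singletons.\<close>
  define T :: "('a + 'a) set" where "T = {Inr (\<sigma> c)} - {Inr c}"
  have \<sigma>B: "\<And>x. x \<in> B \<Longrightarrow> \<sigma> x \<noteq> c \<Longrightarrow> \<sigma> x \<in> B" "\<sigma> c \<noteq> c \<Longrightarrow> \<sigma> c \<in> B"
    using \<sigma>(2) by auto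
  have \<sigma>_eq: "\<And>x y. x \<in> B \<Longrightarrow> y \<in> B \<Longrightarrow> \<sigma> x = \<sigma> y \<longleftrightarrow> x = y"
    "\<And>x. x \<in> B \<Longrightarrow> \<sigma> x \<noteq> \<sigma> c" "\<And>x. x \<in> B \<Longrightarrow> \<sigma> c \<noteq> \<sigma> x"
    using \<sigma>(1) B(2) by (auto simp: inj_on_def)
  have cB: "\<And>x. x \<in> B \<Longrightarrow> x \<noteq> c" "\<And>x. x \<in> B \<Longrightarrow> c \<noteq> x"
    using B(2) by auto
  have S0: "\<And>a. a \<in> S0 \<Longrightarrow> a \<in> B" "\<And>a. a \<in> S0 \<Longrightarrow> \<sigma> a = c"
    "\<And>a a'. a \<in> S0 \<Longrightarrow> a' \<in> S0 \<Longrightarrow> a = a'"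
    using \<sigma>_eq by (auto simp: S0_def)
  have g_vals:
    "\<And>a. a \<in> B \<Longrightarrow> g {Inl c, Inl a} = (if a = k \<or> \<sigma> a = c then 3 else 1)"
    "\<And>b. b \<in> B \<Longrightarrow> g {Inr c, Inr b} = (if b = \<sigma> k \<or> b = \<sigma> c then 1 else 3)"
    "\<And>a b. a \<in> B \<Longrightarrow> b \<in> B \<Longrightarrow> g {Inl a, Inr b} = 2"
    "\<And>a. a \<in> B \<Longrightarrow> \<sigma> a = c \<Longrightarrow> g {Inr c, Inl a} = 3"
    "\<And>b. b \<in> B \<Longrightarrow> g {Inl c, Inr b} = 1"
    unfolding g_def E3_def using B(2) by (simp_all add: doubleton_eq_iff) (auto simp: cB)
  have e_mem:
    "\<And>a. a \<in> B \<Longrightarrow> {Inl c, Inl a} \<in> edges H"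
    "\<And>b. b \<in> B \<Longrightarrow> {Inr c, Inr b} \<in> edges H"
    "\<And>a. a \<in> B \<Longrightarrow> {Inl a, Inr (\<sigma> a)} \<in> edges H"
    "\<And>a. a \<in> B \<Longrightarrow> \<sigma> a = c \<Longrightarrow> {Inr c, Inl a} \<in> edges H"
    "{Inl c, Inr (\<sigma> c)} \<in> edges H"
    unfolding EH by (auto simp: doubleton_eq_iff)
  have "total_proper_connected H f g"
  proof (rule pages_total_proper_connected[where c = "Inl c" and c' = "Inr c" and k = "Inl k"
        and k' = "Inr (\<sigma> k)" and P = Inl and Q = "\<lambda>a. Inr (\<sigma> a)" and I = I and S = S and T = T])
    have "Inl ` B = insert (Inl k) (Inl ` I \<union> S)"
      using k by (auto simp: I_def S_def S0_def)
    moreover have "insert (Inr c) (Inr ` B) = {Inr c, Inr (\<sigma> k)} \<union> (\<lambda>a. Inr (\<sigma> a)) ` I \<union> T"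
    proof -
      \<comment> \<open>By surjectivity every vertex is some \<open>\<sigma> x\<close>, where
        \<open>x\<close> is \<open>c\<close>, \<open>k\<close>, in \<open>I\<close>, or a leaf sent
        to \<open>c\<close>.\<close>
      have "insert c B = {c, \<sigma> k} \<union> \<sigma> ` I \<union> ({\<sigma> c} - {c})"
        using \<sigma>(2) k unfolding I_def by blast
      then have "(Inr ` insert c B :: ('a + 'a) set) = Inr ` ({c, \<sigma> k} \<union> \<sigma> ` I \<union> ({\<sigma> c} - {c}))"
        by simp
      moreover have "Inr ` ({\<sigma> c} - {c}) = T"
        by (auto simp: T_def)
      ultimately show ?thesis
        by (simp only: image_Un image_insert image_empty image_image)
    qed
    ultimately show "verts H = {Inl c, Inr c, Inl k, Inr (\<sigma> k)} \<union> Inl ` I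
        \<union> (\<lambda>a. Inr (\<sigma> a)) ` I \<union> S \<union> T"
      unfolding VH image_insert by blast
    show "inj_on (\<lambda>a. Inr (\<sigma> a)) I"
      by (auto simp: inj_on_def I_def \<sigma>_eq)
  qed (use k B(2) in \<open>auto simp: I_def S_def T_def f_def g_vals e_mem \<sigma>B \<sigma>_eq S0(1,2) intro: S0(3)\<close>)
  moreover have "num_colors H f g \<le> 3"
  proof -
    have "f ` verts H \<union> g ` edges H \<subseteq> {1, 2, 3}"
      by (auto simp: f_def g_def split: sum.splits)
    then have "card (f ` verts H \<union> g ` edges H) \<le> card {1, 2, 3 :: nat}"
      by (intro card_mono) simp_all
    then show ?thesis
      by (simp add: num_colors_def)
  qed
  ultimately have "total_proper_connected H f g \<and> num_colors H f g = 3"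
    using lower by (simp add: le_antisym)
  then show ?thesis
    \<comment> \<open>The constructed coloring attains 3, and \<open>lower\<close> bounds every
      competing one.\<close>
    unfolding tpc_def H_def[symmetric] using lower by (intro Least_equality) blast+
qed

end
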